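(* Let $\varphi(n)\uparrow\infty$ with $n$, let $g_1,g_2,\ldots$ be i.i.d. standard Gaussian random variables, and let $G_n=g_n/\varphi(n)$, $n\ge1$. Put $D=\big(\frac1{\varphi(1)^2}+\frac1{\varphi(2)^2}\big)^{1/2}$. Assume that $\sqrt{\log n}=o(\varphi(n))$, that $\log\varphi(m)=\mathcal{O}(\log m)$, and that $$\int_0^{D}\Big(\log\varphi^{-1}\big(\tfrac1u\big)\Big)^{1/2}\,du<\infty .$$ Let $\varepsilon_n=2^{-n}D$ and put $H(n)=\int_0^{\varepsilon_n}\big(\log\varphi^{-1}(\frac1u)\big)^{1/2}du$, $n\ge0$. For $0<\frac{\varepsilon}{\varphi(1)}<H(1)$, let $n(\varepsilon)$ be such that $H(n(\varepsilon))\le\frac{\varepsilon}{\varphi(1)}$. There exists an absolute constant $C$ such that $$\mathbb{P}\Big\{\sup_{n\ge1}|G_n|\le\frac{2}{\varphi(1)}\,\varepsilon\Big\}\ge C\,e^{-\varphi^{-1}\left(\frac{1}{\varepsilon_{n(\varepsilon)}}\right)\log\frac1\varepsilon}.$$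
   Context: $\varphi^{-1}$ denotes the inverse of $\varphi$. Here $D=\sup_{n,m\ge1}\|G_n-G_m\|_2$ and $1/\varphi(1)=\sup_{n\ge1}\|G_n\|_2$, where $\|\cdot\|_2$ is the $L^2(\mathbb{P})$-norm.
   Formalization: C is absolute only for ε ≤ 9/10; for larger ε in the stated range the constant may depend on φ, and for ε > 1 n(ε) is the least admissible index, since the claim as printed fails there. The probability space lives on one arbitrary carrier set; only the law of the g_n matters. *)

theory Defs
  imports "HOL-Probability.Probability"
begin

text \<open>
  The inverse of a nondecreasing function on \<open>[1, \<infinity>)\<close> that tends to infinity.  It is the ordinary
  inverse where that exists (see \<open>phi_inv_eq\<close>); a sequence \<open>\<phi>\<close> is covered through
  \<open>x \<mapsto> \<phi> \<lfloor>x\<rfloor>\<close>, for which it gives the least \<open>n \<ge> 1\<close> with \<open>y \<le> \<phi> n\<close>.  It is \<open>1\<close> for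
  \<open>y \<le> \<phi> 1\<close>: such arguments \<open>y = 1 / u\<close> do occur, since \<open>D > 1 / \<phi> 1\<close>, and they contribute
  \<open>ln 1 = 0\<close> to the entropy integral.
\<close>

definition phi_inv :: "(real \<Rightarrow> real) \<Rightarrow> real \<Rightarrow> real" where
  "phi_inv \<phi> y = Inf {x. 1 \<le> x \<and> y \<le> \<phi> x}"

lemma phi_inv_eq:
  assumes "strict_mono_on {1..} \<phi>" "1 \<le> x"
  shows "phi_inv \<phi> (\<phi> x) = x"
proof -
  have "{z. 1 \<le> z \<and> \<phi> x \<le> \<phi> z} = {x..}"
    using assms by (auto simp: strict_mono_on_less_eq)
  then show ?thesis by (simp add: phi_inv_def)
qed

lemma phi_inv_below:
  assumes "mono_on {1..} \<phi>" "y \<le> \<phi> 1"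
  shows "phi_inv \<phi> y = 1"
proof -
  have "{z. 1 \<le> z \<and> y \<le> \<phi> z} = {1..}"
    using assms by (auto dest: mono_onD[of _ _ 1] intro: order_trans)
  then show ?thesis by (simp add: phi_inv_def)
qed

definition diam :: "(real \<Rightarrow> real) \<Rightarrow> real" where
  "diam \<phi> = sqrt (1 / (\<phi> 1)\<^sup>2 + 1 / (\<phi> 2)\<^sup>2)"

definition eps :: "(real \<Rightarrow> real) \<Rightarrow> nat \<Rightarrow> real" where
  "eps \<phi> n = diam \<phi> / 2 ^ n"

definition entropy_integrand :: "(real \<Rightarrow> real) \<Rightarrow> real \<Rightarrow> real" where
  "entropy_integrand \<phi> u = sqrt (ln (phi_inv \<phi> (1 / u)))"

definition H :: "(real \<Rightarrow> real) \<Rightarrow> nat \<Rightarrow> real" where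
  "H \<phi> n = set_lebesgue_integral lborel {0<..eps \<phi> n} (entropy_integrand \<phi>)"

end

(*
By independence the probability is the product over k of P(|g_k| <= c_k) with
c_k = 2 eps phi(k) / phi(1) >= 2 eps.  Put N = phi^-1(1 / eps_n).

For k <= N and eps <= 9/10 the factor is at least P(|g| <= 2 eps) >= eps, and there are at most N
such k; the last inequality fails for eps near 1, which is why larger eps need another constant.

For k > N the entropy integrand is at least sqrt(ln k) on (0, 1/phi(k)), an interval inside
(0, eps_n], so that sqrt(ln k) / phi(k) <= H(n) <= eps / phi(1), that is c_k >= 2 sqrt(ln k).  By the
Gaussian tail bound P(|g| > x) <= exp(-x^2/2) the factor is at least 1 - 1/k^2, and the product of
these over k >= 2 is 1/2.

For eps > 9/10 the probability is bounded below by that for eps = 9/10, which is positive because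
sqrt(ln k) = o(phi(k)); the factor eps^N on the right is bounded because eps < phi(1) H(1) and
the minimality of n bounds N.
*)

theory Submission
  imports Defs
begin

section \<open>Gaussian tail bound\<close>

abbreviation std_normal :: "real measure" where
  "std_normal \<equiv> density lborel (\<lambda>x. ennreal (std_normal_density x))"

interpretation std_normal: prob_space std_normal
  by (rule prob_space_normal_density) simp

lemma std_normal_density_shift_le:
  assumes "0 \<le> x * s"
  shows "std_normal_density (x + s) \<le> exp (- x\<^sup>2 / 2) * std_normal_density s"
proof -
  have "- (x + s)\<^sup>2 / 2 \<le> - x\<^sup>2 / 2 + - s\<^sup>2 / 2"
    using assms by (simp add: power2_eq_square field_simps)
  then have "exp (- (x + s)\<^sup>2 / 2) \<le> exp (- x\<^sup>2 / 2) * exp (- s\<^sup>2 / 2)"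
    by (simp only: exp_add[symmetric] exp_le_cancel_iff)
  then show ?thesis
    by (simp add: std_normal_density_def divide_right_mono)
qed

text \<open>Substitute \<open>t = x + s\<close> and drop the cross term \<open>x * s\<close> in the
  exponent, which has the right sign on \<open>A\<close>. Keeping the factor
  \<open>measure std_normal A\<close> saves a factor 2 when two tails are added.\<close>

lemma std_normal_measure_shift_le:
  assumes [measurable]: "A \<in> sets borel" and A: "\<And>s. s \<in> A \<Longrightarrow> 0 \<le> x * s"
  shows "measure std_normal {t. t - x \<in> A} \<le> exp (- x\<^sup>2 / 2) * measure std_normal A"
proof -
  have [measurable]: "{t. t - x \<in> A} \<in> sets borel"
    by measurable
  have "emeasure std_normal {t. t - x \<in> A}
      = (\<integral>\<^sup>+t. std_normal_density t * indicator {t. t - x \<in> A} t \<partial>lborel)"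
    by (simp add: emeasure_density nn_integral_set_ennreal)
  also have "\<dots> = (\<integral>\<^sup>+s. std_normal_density (x + s) * indicator A s \<partial>lborel)"
    by (subst nn_integral_real_affine[where c = 1 and t = x]) (auto simp: indicator_def)
  also have "\<dots> \<le> (\<integral>\<^sup>+s. ennreal (exp (- x\<^sup>2 / 2)) * (std_normal_density s * indicator A s) \<partial>lborel)"
    using A by (intro nn_integral_mono)
      (auto simp: indicator_def ennreal_mult[symmetric] intro!: ennreal_leI std_normal_density_shift_le[simplified])
  also have "\<dots> = ennreal (exp (- x\<^sup>2 / 2)) * emeasure std_normal A"
    by (subst nn_integral_cmult) (auto simp: emeasure_density nn_integral_set_ennreal)
  finally show ?thesis
    by (simp add: std_normal.emeasure_eq_measure ennreal_mult[symmetric])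
qed

text \<open>Each tail is a translate of an open half-line at 0, and the two half-lines have total
  mass at most 1. So the constant in front of the exponential is 1, which makes the complement at
  most \<open>1 / k^2\<close> for \<open>x = 2 * sqrt (ln k)\<close>.\<close>

lemma std_normal_interval_ge_tail:
  assumes "0 \<le> x"
  shows "1 - exp (- x\<^sup>2 / 2) \<le> measure std_normal {-x..x}"
proof -
  have shifts: "{t. t - x \<in> {0<..}} = {x<..}" "{t. t - (- x) \<in> {..<0}} = {..<-x}"
    by auto
  have "measure std_normal {x<..} \<le> exp (- x\<^sup>2 / 2) * measure std_normal {0<..}"
    using std_normal_measure_shift_le[of "{0<..}" x] assms by (simp only: shifts) auto
  moreover have "measure std_normal {..<-x} \<le> exp (- x\<^sup>2 / 2) * measure std_normal {..<0}"
    using std_normal_measure_shift_le[of "{..<0}" "- x"] assms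
    by (simp only: shifts) (auto simp: mult_nonneg_nonpos)
  moreover have "measure std_normal {0<..} + measure std_normal {..<0} \<le> 1"
    by (subst std_normal.finite_measure_Union[symmetric]) auto
  moreover have "1 - measure std_normal {-x..x} = measure std_normal (space std_normal - {-x..x})"
    by (rule std_normal.prob_compl[symmetric]) auto
  moreover have "\<dots> = measure std_normal ({x<..} \<union> {..<-x})"
    by (rule arg_cong[of _ _ "measure std_normal"]) auto
  moreover have "\<dots> = measure std_normal {x<..} + measure std_normal {..<-x}"
    using assms by (intro std_normal.finite_measure_Union) auto
  ultimately have "1 - measure std_normal {-x..x}
      \<le> exp (- x\<^sup>2 / 2) * (measure std_normal {0<..} + measure std_normal {..<0})"
    by (simp add: algebra_simps)
  also have "\<dots> \<le> exp (- x\<^sup>2 / 2) * 1"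
    using \<open>measure std_normal {0<..} + measure std_normal {..<0} \<le> 1\<close>
    by (intro mult_left_mono) auto
  finally show ?thesis by simp
qed

section \<open>Linear lower bound for the Gaussian measure of short intervals\<close>

text \<open>Stopping at an odd degree leaves a Lagrange remainder with the even power 6, hence of
  positive sign.\<close>

lemma exp_uminus_ge_Taylor5:
  fixes y :: real
  assumes "0 \<le> y"
  shows "1 - y + y^2 / 2 - y^3 / 6 + y^4 / 24 - y^5 / 120 \<le> exp (- y)"
proof -
  obtain t where "exp (- y) = (\<Sum>m<6. (- y) ^ m / fact m) + exp t / fact 6 * (- y) ^ 6"
    using Maclaurin_exp_le[of "- y" 6] by blast
  moreover have "0 \<le> exp t / fact 6 * (- y) ^ 6"
    by simp
  ultimately show ?thesis
    by (simp add: eval_nat_numeral)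
qed

text \<open>
  Up to the factor \<open>2 * x\<close>, the polynomial is the integral over \<open>{-x..x}\<close> of the
  fifth Taylor polynomial of \<open>exp (- t\<^sup>2 / 2)\<close>, with \<open>z = x\<^sup>2\<close>; the constant \<open>0.6275\<close> exceeds
  \<open>sqrt (2 * pi) / 4\<close> by less than \<open>0.001\<close>.
\<close>

lemma poly_ge_on_interval:
  fixes z :: real
  assumes "0 \<le> z" "z \<le> 3.24"
  shows "0.6275 \<le> 1 - z / 6 + z^2 / 40 - z^3 / 336 + z^4 / 3456 - z^5 / 42240"
proof -
  define q :: "real \<Rightarrow> real"
    where "q z = 1 - z / 6 + z^2 / 40 - z^3 / 336 + z^4 / 3456 - z^5 / 42240" for z
  have "q z \<ge> q 3.24"
  proof (rule DERIV_nonpos_imp_nonincreasing[OF assms(2)])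
    fix x :: real assume x: "z \<le> x" "x \<le> 3.24"
    \<comment> \<open>The derivative of \<open>q\<close> is nonpositive because its terms pair up:
      \<open>x / 20\<close> is dominated by \<open>1 / 6\<close>, and \<open>x^3 / 864\<close> by
      \<open>x^2 / 112\<close>.\<close>
    have "x^2 * (x / 864 - 1 / 112) \<le> 0"
      using x assms by (intro mult_nonneg_nonpos) auto
    then have "x^3 / 864 - x^2 / 112 \<le> 0"
      by (simp add: algebra_simps power2_eq_square power3_eq_cube)
    moreover have "x / 20 \<le> 1 / 6"
      using x by simp
    moreover have "0 \<le> x^4 / 8448" by simp
    ultimately have "- (1 / 6) + x / 20 - x^2 / 112 + x^3 / 864 - x^4 / 8448 \<le> 0"
      by linarith
    moreover have "(q has_real_derivative (- (1 / 6) + x / 20 - x^2 / 112 + x^3 / 864 - x^4 / 8448)) (at x)"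
      unfolding q_def by (auto intro!: derivative_eq_intros)
    ultimately show "\<exists>y. (q has_real_derivative y) (at x) \<and> y \<le> 0"
      by blast
  qed
  moreover have "0.6275 \<le> q 3.24"
    by (simp add: q_def eval_nat_numeral)
  ultimately show ?thesis by (simp add: q_def)
qed

text \<open>Integrates a polynomial minorant of the density. The range ends at
  \<open>1.8 = 2 * 0.9\<close> because the bound is applied at \<open>x = 2 * b\<close> with
  \<open>b\<close> at most \<open>0.9\<close>.\<close>

lemma std_normal_interval_ge_half:
  assumes "0 \<le> x" "x \<le> 1.8"
  shows "x / 2 \<le> measure std_normal {-x..x}"
proof -
  \<comment> \<open>\<open>p\<close> is the Taylor minorant of \<open>exp (- t^2 / 2)\<close>, and
    \<open>P\<close> its odd antiderivative, so that \<open>P x - P (- x) = 2 * P x\<close>.\<close>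
  define p :: "real \<Rightarrow> real" where
    "p t = 1 - t^2/2 + (t^2/2)^2 / 2 - (t^2/2)^3 / 6 + (t^2/2)^4 / 24 - (t^2/2)^5 / 120" for t
  define P :: "real \<Rightarrow> real" where
    "P t = t - t^3 / 6 + t^5 / 40 - t^7 / 336 + t^9 / 3456 - t^11 / 42240" for t
  have cont: "isCont p t" for t
    unfolding p_def by (intro continuous_intros) auto
  have P: "(P has_real_derivative p t) (at t)" for t
    unfolding p_def P_def by (auto intro!: derivative_eq_intros simp: power_divide field_simps)
  have int_p: "has_bochner_integral lborel (\<lambda>t. p t * indicator {-x..x} t) (P x - P (- x))"
    using assms P cont by (intro has_bochner_integral_FTC_Icc_real) auto
  have "x / 2 \<le> 2 * P x / sqrt (2 * pi)"
  proof -
    have z: "0 \<le> x^2" "x^2 \<le> 3.24"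
      using power_mono[of x "1.8" 2] assms by (auto simp: power2_eq_square)
    \<comment> \<open>\<open>2.51^2 = 6.3001\<close> lies just above \<open>2 * pi\<close>, and
      \<open>2.51 = 4 * 0.6275\<close> matches the polynomial bound.\<close>
    have "sqrt (2 * pi) \<le> sqrt (2.51^2)"
      using pi_approx by (intro real_sqrt_le_mono) (simp add: power2_eq_square)
    then have "sqrt (2 * pi) \<le> 2.51"
      by simp
    then have "x * sqrt (2 * pi) \<le> x * 2.51"
      using assms by (intro mult_left_mono) auto
    also have "\<dots> = 4 * (x * 0.6275)" by simp
    also have "x * 0.6275 \<le> x * (1 - x^2 / 6 + (x^2)^2 / 40 - (x^2)^3 / 336 + (x^2)^4 / 3456 - (x^2)^5 / 42240)"
      using assms by (intro mult_left_mono poly_ge_on_interval z) auto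
    also have "\<dots> = P x"
      by (simp add: P_def algebra_simps eval_nat_numeral)
    finally show ?thesis by (simp add: field_simps)
  qed
  also have "\<dots> = (P x - P (- x)) / sqrt (2 * pi)"
    by (simp add: P_def)
  also have "\<dots> = (\<integral>t. (1 / sqrt (2 * pi)) * (p t * indicator {-x..x} t) \<partial>lborel)"
    using has_bochner_integral_integral_eq[OF int_p] by (subst integral_mult_right_zero) simp
  also have "\<dots> \<le> (\<integral>t. std_normal_density t * indicator {-x..x} t \<partial>lborel)"
  proof (rule integral_mono)
    show "integrable lborel (\<lambda>t. (1 / sqrt (2 * pi)) * (p t * indicator {-x..x} t))"
      using int_p by (intro integrable_mult_right) (auto simp: has_bochner_integral_iff)
    show "integrable lborel (\<lambda>t. std_normal_density t * indicator {-x..x} t)"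
      by (intro integrable_real_mult_indicator) auto
    fix t :: real
    have "p t \<le> exp (- t\<^sup>2 / 2)"
      using exp_uminus_ge_Taylor5[of "t^2/2"] by (simp add: p_def)
    then show "(1 / sqrt (2 * pi)) * (p t * indicator {-x..x} t) \<le> std_normal_density t * indicator {-x..x} t"
      by (auto simp: std_normal_density_def indicator_def divide_right_mono)
  qed
  also have "\<dots> = measure std_normal {-x..x}"
    by (simp add: measure_def emeasure_density nn_integral_set_ennreal integral_eq_nn_integral)
  finally show ?thesis .
qed

section \<open>Infinite products of interval probabilities\<close>

text \<open>Telescopes through \<open>1 - 1 / k^2 = (k - 1) * (k + 1) / k^2\<close>. The factor at
  \<open>k = 1\<close> would vanish and is replaced by 1.\<close>

lemma prod_one_minus_inverse_square:
  assumes "1 \<le> m"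
  shows "(\<Prod>k\<in>{1..m::nat}. if k = 1 then 1 else 1 - 1 / (real k)\<^sup>2) = (real m + 1) / (2 * real m)"
  using assms
proof (induction m rule: dec_induct)
  case base
  then show ?case by simp
next
  case (step m)
  have "(\<Prod>k\<in>{1..Suc m}. if k = 1 then 1 else 1 - 1 / (real k)\<^sup>2)
      = (real m + 1) / (2 * real m) * (1 - 1 / (real (Suc m))\<^sup>2)"
    using step by (simp add: prod.cl_ivl_Suc)
  also have "\<dots> = (real (Suc m) + 1) / (2 * real (Suc m))"
    using step by (simp add: divide_simps) (simp add: algebra_simps power2_eq_square)
  finally show ?case .
qed

text \<open>Each \<open>f k\<close> dominates \<open>?a k * ?c k\<close>. Leaving
  \<open>?c k\<close> in for \<open>k \<le> K\<close> is harmless: it is at most 1 there, and the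
  product of all \<open>?c k\<close> is still at least 1/2. The bound does not depend on
  \<open>m\<close>, so it survives the limit.\<close>

lemma prod_ge_half_power:
  fixes f :: "nat \<Rightarrow> real"
  assumes b: "0 \<le> b" "b \<le> 1" and K: "1 \<le> K"
    and small: "\<And>k. 1 \<le> k \<Longrightarrow> k \<le> K \<Longrightarrow> b \<le> f k"
    and large: "\<And>k. K < k \<Longrightarrow> 1 - 1 / (real k)\<^sup>2 \<le> f k"
  shows "b ^ K / 2 \<le> (\<Prod>k\<in>{1..m}. f k)"
proof (cases "m = 0")
  case True
  then show ?thesis using b power_le_one[of b K] by simp
next
  case False
  let ?a = "\<lambda>k. if k \<le> K then b else 1"
  let ?c = "\<lambda>k::nat. if k = 1 then 1 else 1 - 1 / (real k)\<^sup>2"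
  \<comment> \<open>For \<open>m < K\<close> fewer than \<open>K\<close> factors \<open>b\<close>
    occur; since \<open>b \<le> 1\<close>, this only enlarges the product.\<close>
  have "card ({1..m} \<inter> {k. k \<le> K}) \<le> card {1..K}"
    by (intro card_mono) auto
  then have "b ^ K \<le> b ^ card ({1..m} \<inter> {k. k \<le> K})"
    using b by (intro power_decreasing) auto
  also have "\<dots> = (\<Prod>k\<in>{1..m}. ?a k)"
    by (simp add: prod.If_cases)
  finally have A: "b ^ K \<le> (\<Prod>k\<in>{1..m}. ?a k)" .
  have B: "1 / 2 \<le> (\<Prod>k\<in>{1..m}. ?c k)"
    using False by (subst prod_one_minus_inverse_square) (auto simp: field_simps)
  have c: "0 \<le> ?c k" "?c k \<le> 1" if "k \<in> {1..m}" for k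
    using that one_le_power[of "real k" 2] by (auto simp: divide_simps)
  have "b ^ K / 2 \<le> (\<Prod>k\<in>{1..m}. ?a k) * (\<Prod>k\<in>{1..m}. ?c k)"
    using mult_mono[OF A B] b A by (simp add: prod_nonneg)
  also have "\<dots> = (\<Prod>k\<in>{1..m}. ?a k * ?c k)"
    by (rule prod.distrib[symmetric])
  also have "\<dots> \<le> (\<Prod>k\<in>{1..m}. f k)"
  proof (intro prod_mono conjI)
    fix k assume k: "k \<in> {1..m}"
    show "0 \<le> ?a k * ?c k"
      using c[OF k] b by (intro mult_nonneg_nonneg) auto
    show "?a k * ?c k \<le> f k"
    proof (cases "k \<le> K")
      case True
      have "b * ?c k \<le> b * 1" using c[OF k] b by (intro mult_left_mono)
      then show ?thesis using small[of k] k True by auto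
    next
      case False
      then show ?thesis using large[of k] K by auto
    qed
  qed
  finally show ?thesis .
qed

context prob_space
begin

text \<open>Independence evaluates the finite intersections, and continuity from above passes the
  uniform bound \<open>L\<close> to the countable one.\<close>

lemma prob_indep_std_normal_bounded:
  fixes g :: "nat \<Rightarrow> 'a \<Rightarrow> real" and c :: "nat \<Rightarrow> real"
  assumes indep: "indep_vars (\<lambda>_. borel) g {1..}"
    and g: "\<And>k. 1 \<le> k \<Longrightarrow> distributed M lborel (g k) std_normal_density"
    and L: "\<And>m. L \<le> (\<Prod>k\<in>{1..m}. measure std_normal {- c k..c k})"
  shows "L \<le> prob {\<omega> \<in> space M. \<forall>k\<ge>1. \<bar>g k \<omega>\<bar> \<le> c k}"
proof -
  define A where "A k = g k -` {- c k..c k} \<inter> space M" for k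
  have meas: "g k \<in> borel_measurable M" if "1 \<le> k" for k
    using indep that by (auto simp: indep_vars_def)
  have A: "A k \<in> events" if "1 \<le> k" for k
    unfolding A_def using meas[OF that] by (rule measurable_sets) auto
  have prob_A: "prob (A k) = measure std_normal {- c k..c k}" if "1 \<le> k" for k
    unfolding distributed_distr_eq_density[OF g[OF that], symmetric] A_def
    using distributed_measurable[OF g[OF that]] by (subst measure_distr) auto
  \<comment> \<open>\<open>Suc m\<close> keeps the index set nonempty: an empty intersection would
    be the whole type instead of \<open>space M\<close>.\<close>
  define E where "E m = (\<Inter>k\<in>{1..Suc m}. A k)" for m
  have "(\<lambda>m. prob (E m)) \<longlonglongrightarrow> prob (\<Inter>m. E m)"
  proof (rule finite_Lim_measure_decseq)
    show "range E \<subseteq> events"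
      unfolding E_def using A by (auto intro!: sets.finite_INT)
    show "decseq E"
      unfolding E_def decseq_def by (auto 4 3)
  qed
  moreover have "L \<le> prob (E m)" for m
  proof -
    have "prob (E m) = (\<Prod>k\<in>{1..Suc m}. prob (A k))"
      unfolding E_def A_def by (rule indep_varsD[OF indep]) auto
    also have "\<dots> = (\<Prod>k\<in>{1..Suc m}. measure std_normal {- c k..c k})"
      by (intro prod.cong) (auto simp: prob_A)
    finally show ?thesis using L[of "Suc m"] by simp
  qed
  ultimately have "L \<le> prob (\<Inter>m. E m)"
    by (intro LIMSEQ_le_const[of _ _ L]) auto
  also have "(\<Inter>m. E m) = {\<omega> \<in> space M. \<forall>k\<ge>1. \<bar>g k \<omega>\<bar> \<le> c k}"
    unfolding E_def A_def by (auto simp: abs_le_iff minus_le_iff Suc_le_eq) (metis Suc_le_eq atLeastAtMost_iff le_Suc_eq order_refl)+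
  finally show ?thesis .
qed

text \<open>The common core of both ranges of \<open>\<epsilon>\<close>: it serves with
  \<open>b = \<epsilon>\<close> for small \<open>\<epsilon>\<close> and with \<open>b = 0.9\<close>
  for the others.\<close>

lemma prob_indep_std_normal_bounded_ge:
  fixes g :: "nat \<Rightarrow> 'a \<Rightarrow> real" and c :: "nat \<Rightarrow> real"
  assumes "indep_vars (\<lambda>_. borel) g {1..}"
    and "\<And>k. 1 \<le> k \<Longrightarrow> distributed M lborel (g k) std_normal_density"
    and b: "0 \<le> b" "b \<le> 0.9" and K: "1 \<le> K"
    and small: "\<And>k. 1 \<le> k \<Longrightarrow> k \<le> K \<Longrightarrow> 2 * b \<le> c k"
    and large: "\<And>k. K < k \<Longrightarrow> 2 * sqrt (ln (real k)) \<le> c k"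
  shows "b ^ K / 2 \<le> prob {\<omega> \<in> space M. \<forall>k\<ge>1. \<bar>g k \<omega>\<bar> \<le> c k}"
proof (rule prob_indep_std_normal_bounded[OF assms(1,2)])
  fix m
  show "b ^ K / 2 \<le> (\<Prod>k\<in>{1..m}. measure std_normal {- c k..c k})"
  proof (rule prod_ge_half_power)
    fix k assume "1 \<le> k" "k \<le> K"
    from small[OF this] have "{-(2*b)..2*b} \<subseteq> {- c k..c k}" by auto
    then have "measure std_normal {-(2*b)..2*b} \<le> measure std_normal {- c k..c k}"
      by (intro std_normal.finite_measure_mono) auto
    with std_normal_interval_ge_half[of "2 * b"] b
    show "b \<le> measure std_normal {- c k..c k}" by auto
  next
    fix k assume k: "K < k"
    have "{-(2 * sqrt (ln (real k)))..2 * sqrt (ln (real k))} \<subseteq> {- c k..c k}"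
      using large[OF k] by auto
    then have "measure std_normal {-(2 * sqrt (ln (real k)))..2 * sqrt (ln (real k))}
        \<le> measure std_normal {- c k..c k}"
      by (intro std_normal.finite_measure_mono) auto
    moreover have "exp (- (2 * sqrt (ln (real k)))\<^sup>2 / 2) = 1 / (real k)\<^sup>2"
      using k K by (simp add: power_mult_distrib exp_minus exp_double inverse_eq_divide)
    moreover have "0 \<le> ln (real k)"
      using k K by simp
    ultimately show "1 - 1 / (real k)\<^sup>2 \<le> measure std_normal {- c k..c k}"
      using std_normal_interval_ge_tail[of "2 * sqrt (ln (real k))"] by auto
  qed (use b K in auto)
qed

end

section \<open>The generalized inverse and the entropy integral\<close>

locale entropy_sequence =
  fixes \<phi> :: "real \<Rightarrow> real"
  assumes phi_1_pos: "0 < \<phi> 1"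
    and phi_mono: "mono_on {1..} \<phi>"
    and phi_top: "filterlim \<phi> at_top at_top"
    and integrable_entropy: "set_integrable lborel {0<..diam \<phi>} (entropy_integrand \<phi>)"
begin

lemma phi_ge: "1 \<le> x \<Longrightarrow> \<phi> 1 \<le> \<phi> x"
  using phi_mono by (auto dest: mono_onD)

lemma diam_pos: "0 < diam \<phi>"
  using phi_1_pos by (simp add: diam_def add_pos_nonneg)

lemma eps_pos: "0 < eps \<phi> n"
  using diam_pos by (simp add: eps_def)

lemma eps_antimono: "m \<le> n \<Longrightarrow> eps \<phi> n \<le> eps \<phi> m"
  using diam_pos by (simp add: eps_def divide_simps)

lemma eps_le_diam: "eps \<phi> n \<le> diam \<phi>"
  using eps_antimono[of 0 n] by (simp add: eps_def)

lemma phi_inv_set_nonempty: "{x. 1 \<le> x \<and> y \<le> \<phi> x} \<noteq> {}"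
proof -
  have "eventually (\<lambda>x. 1 \<le> x \<and> y \<le> \<phi> x) at_top"
    using phi_top by (intro eventually_conj eventually_ge_at_top) (simp add: filterlim_at_top)
  then show ?thesis
    by (auto dest: eventually_happens)
qed

lemma phi_inv_greatest:
  assumes "\<And>x. 1 \<le> x \<Longrightarrow> y \<le> \<phi> x \<Longrightarrow> c \<le> x"
  shows "c \<le> phi_inv \<phi> y"
  unfolding phi_inv_def by (intro cInf_greatest phi_inv_set_nonempty) (use assms in auto)

lemma phi_inv_ge_1: "1 \<le> phi_inv \<phi> y"
  by (rule phi_inv_greatest)

lemma phi_inv_mono: "y \<le> z \<Longrightarrow> phi_inv \<phi> y \<le> phi_inv \<phi> z"
  unfolding phi_inv_def
  by (intro cInf_superset_mono phi_inv_set_nonempty bdd_belowI[of _ 1]) auto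

text \<open>The inequality is strict because \<open>\<phi>\<close> may jump, so that the infimum
  defining \<open>phi_inv\<close> need not be attained. A point of the set below \<open>x\<close>
  always exists, and monotonicity does the rest.\<close>

lemma phi_ge_of_phi_inv_less:
  assumes "phi_inv \<phi> y < x"
  shows "y \<le> \<phi> x"
proof -
  obtain z where "1 \<le> z" "y \<le> \<phi> z" "z < x"
    using cInf_lessD[OF phi_inv_set_nonempty assms[unfolded phi_inv_def]] by auto
  then show ?thesis
    using phi_mono by (fastforce dest: mono_onD[of _ _ z x])
qed

lemma phi_inv_ge_of_phi_less:
  assumes "1 \<le> x" "\<phi> x < y"
  shows "x \<le> phi_inv \<phi> y"
proof (rule phi_inv_greatest)
  fix z assume "1 \<le> z" "y \<le> \<phi> z"
  then show "x \<le> z"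
    using assms mono_onD[OF phi_mono, of z x] by force
qed

lemma entropy_integrand_nonneg: "0 \<le> entropy_integrand \<phi> u"
  using phi_inv_ge_1 by (simp add: entropy_integrand_def)

lemma integrable_entropy_eps: "set_integrable lborel {0<..eps \<phi> n} (entropy_integrand \<phi>)"
  by (rule set_integrable_subset[OF integrable_entropy]) (use eps_le_diam[of n] in auto)

text \<open>A rectangle of height \<open>sqrt (ln k)\<close> and width \<open>1 / \<phi> k\<close>
  fits under the graph. This turns the bound on the integral into a pointwise one on
  \<open>\<phi> k\<close>.\<close>

lemma sqrt_ln_div_phi_le_H:
  assumes "phi_inv \<phi> (1 / eps \<phi> n) < real k"
  shows "sqrt (ln (real k)) / \<phi> (real k) \<le> H \<phi> n"
proof -
  have k: "1 \<le> real k"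
    using assms phi_inv_ge_1[of "1 / eps \<phi> n"] by linarith
  have pos: "0 < \<phi> (real k)"
    using phi_ge[OF k] phi_1_pos by linarith
  txt \<open>The entropy integrand is at least \<open>sqrt (ln k)\<close> on all of \<open>{0<..<1 / \<phi> k}\<close>.\<close>
  let ?u = "1 / \<phi> (real k)"
  have u: "?u \<le> eps \<phi> n"
    using phi_ge_of_phi_inv_less[OF assms] pos eps_pos[of n] by (simp add: field_simps)
  have le: "sqrt (ln (real k)) \<le> entropy_integrand \<phi> v" if "0 < v" "v < ?u" for v
  proof -
    have "\<phi> (real k) < 1 / v" using that pos by (simp add: field_simps)
    from phi_inv_ge_of_phi_less[OF k this] k show ?thesis
      by (simp add: entropy_integrand_def)
  qed
  have "sqrt (ln (real k)) / \<phi> (real k) = (\<integral>v. indicator {0<..<?u} v *\<^sub>R sqrt (ln (real k)) \<partial>lborel)"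
    using pos by simp
  also have "\<dots> \<le> (\<integral>v. indicator {0<..eps \<phi> n} v *\<^sub>R entropy_integrand \<phi> v \<partial>lborel)"
  proof (rule integral_mono)
    show "integrable lborel (\<lambda>v. indicator {0<..<?u} v *\<^sub>R sqrt (ln (real k)))"
      using pos by (intro integrable_scaleR_left) (auto intro: integrable_real_indicator)
    show "integrable lborel (\<lambda>v. indicator {0<..eps \<phi> n} v *\<^sub>R entropy_integrand \<phi> v)"
      using integrable_entropy_eps by (simp add: set_integrable_def)
    fix v
    show "indicator {0<..<?u} v *\<^sub>R sqrt (ln (real k))
        \<le> indicator {0<..eps \<phi> n} v *\<^sub>R entropy_integrand \<phi> v"
      using u le[of v] entropy_integrand_nonneg[of v] by (auto simp: indicator_def)
  qed
  finally show ?thesis by (simp add: H_def set_lebesgue_integral_def)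
qed

text \<open>Dominated convergence, with the integrand of \<open>H \<phi> 0\<close> as majorant. It
  supplies a single index that bounds the minimal \<open>n\<close> for every
  \<open>\<epsilon> > 1\<close>.\<close>

lemma H_tendsto_0: "H \<phi> \<longlonglongrightarrow> 0"
proof -
  let ?f = "\<lambda>n u. indicator {0<..eps \<phi> n} u *\<^sub>R entropy_integrand \<phi> u"
  have int: "integrable lborel (?f n)" for n
    using integrable_entropy_eps by (simp add: set_integrable_def)
  have eps0: "eps \<phi> \<longlonglongrightarrow> 0"
    unfolding eps_def[abs_def] by (rule LIMSEQ_divide_realpow_zero) simp
  have "(\<lambda>n. \<integral>u. ?f n u \<partial>lborel) \<longlonglongrightarrow> (\<integral>u. 0 \<partial>(lborel :: real measure))"
  proof (rule integral_dominated_convergence)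
    show "integrable lborel (?f 0)" by (rule int)
    show "?f n \<in> borel_measurable lborel" for n
      using int by (rule borel_measurable_integrable)
    show "AE u in lborel. (\<lambda>n. ?f n u) \<longlonglongrightarrow> 0"
    proof (rule AE_I2)
      fix u :: real
      show "(\<lambda>n. ?f n u) \<longlonglongrightarrow> 0"
      proof (cases "0 < u")
        case True
        have "eventually (\<lambda>n. eps \<phi> n < u) sequentially"
          using order_tendstoD(2)[OF eps0 True] .
        then have "eventually (\<lambda>n. ?f n u = 0) sequentially"
          by eventually_elim (auto simp: indicator_def)
        then show ?thesis by (rule tendsto_eventually)
      qed simp
    qed
    show "AE u in lborel. norm (?f n u) \<le> ?f 0 u" for n
      using entropy_integrand_nonneg eps_antimono[of 0 n]
      by (intro AE_I2) (auto simp: indicator_def)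
  qed simp
  then show ?thesis
    by (simp add: H_def[abs_def] set_lebesgue_integral_def)
qed

end

section \<open>The small ball estimate\<close>

text \<open>In the extended reals an unbounded path has supremum infinity, so it is correctly
  excluded from the event.\<close>

lemma ereal_SUP_abs_div_le_iff:
  fixes x c :: "nat \<Rightarrow> real"
  assumes "\<And>k. 1 \<le> k \<Longrightarrow> 0 < c k"
  shows "(SUP k\<in>{1..}. ereal \<bar>x k / c k\<bar>) \<le> ereal a \<longleftrightarrow> (\<forall>k\<ge>1. \<bar>x k\<bar> \<le> a * c k)"
proof -
  have "ereal \<bar>x k / c k\<bar> \<le> ereal a \<longleftrightarrow> \<bar>x k\<bar> \<le> a * c k" if "1 \<le> k" for k
    using assms[OF that] by (simp add: abs_divide pos_divide_le_eq)
  then show ?thesis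
    by (auto simp: SUP_le_iff)
qed

text \<open>\<open>C\<close> is absolute, while \<open>C'\<close> may depend on
  \<open>\<phi>\<close> but not on \<open>M\<close>, \<open>g\<close>, \<open>\<epsilon>\<close> or
  \<open>n\<close>. Minimality of \<open>n\<close> is imposed for \<open>\<epsilon> > 1\<close>,
  where the exponential on the right equals \<open>\<epsilon>\<close> to a power that tends to
  infinity with \<open>n\<close>.\<close>

theorem theorem4p1:
  "\<exists>C>0. \<forall>\<phi> :: real \<Rightarrow> real.
     0 < \<phi> 1 \<and> mono_on {1..} \<phi> \<and> filterlim \<phi> at_top at_top \<and>
     (\<lambda>n::nat. sqrt (ln (real n))) \<in> o(\<lambda>n. \<phi> (real n)) \<and>
     (\<lambda>m::nat. ln (\<phi> (real m))) \<in> O(\<lambda>m. ln (real m)) \<and>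
     set_integrable lborel {0<..diam \<phi>} (entropy_integrand \<phi>) \<longrightarrow>
     (\<exists>C'>0. \<forall>(M :: 'a measure) (g :: nat \<Rightarrow> 'a \<Rightarrow> real) \<epsilon> n.
        prob_space M \<and>
        prob_space.indep_vars M (\<lambda>_. borel) g {1..} \<and>
        (\<forall>k\<ge>1. distributed M lborel (g k) std_normal_density) \<and>
        0 < \<epsilon> / \<phi> 1 \<and> \<epsilon> / \<phi> 1 < H \<phi> 1 \<and> H \<phi> n \<le> \<epsilon> / \<phi> 1 \<and>
        (\<epsilon> \<le> 1 \<or> (\<forall>m. H \<phi> m \<le> \<epsilon> / \<phi> 1 \<longrightarrow> n \<le> m)) \<longrightarrow>
        measure M {\<omega> \<in> space M. (SUP k\<in>{1..}. ereal \<bar>g k \<omega> / \<phi> (real k)\<bar>) \<le> ereal (2 / \<phi> 1 * \<epsilon>)}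
          \<ge> (if \<epsilon> \<le> 9 / 10 then C else C') * exp (- phi_inv \<phi> (1 / eps \<phi> n) * ln (1 / \<epsilon>)))"
proof (rule exI[of _ "1 / 2"], intro conjI allI impI)
  show "(0 :: real) < 1 / 2" by simp
next
  fix \<phi> :: "real \<Rightarrow> real"
  assume hyps: "0 < \<phi> 1 \<and> mono_on {1..} \<phi> \<and> filterlim \<phi> at_top at_top \<and>
     (\<lambda>n::nat. sqrt (ln (real n))) \<in> o(\<lambda>n. \<phi> (real n)) \<and>
     (\<lambda>m::nat. ln (\<phi> (real m))) \<in> O(\<lambda>m. ln (real m)) \<and>
     set_integrable lborel {0<..diam \<phi>} (entropy_integrand \<phi>)"
  then interpret entropy_sequence \<phi>
    by unfold_locales auto
  have phi_pos: "0 < \<phi> (real k)" if "1 \<le> k" for k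
    using phi_ge[of "real k"] phi_1_pos that by auto
  \<comment> \<open>The constant \<open>0.9 / \<phi> 1\<close> is chosen so that doubling gives
    \<open>2 * sqrt (ln k) \<le> c k\<close> as soon as \<open>\<epsilon> > 9 / 10\<close>.\<close>
  have "eventually (\<lambda>n::nat. norm (sqrt (ln (real n))) \<le> 0.9 / \<phi> 1 * norm (\<phi> (real n))) sequentially"
    using hyps phi_1_pos by (intro landau_o.smallD) auto
  then obtain K0 where K0: "\<And>k. K0 \<le> k \<Longrightarrow> norm (sqrt (ln (real k))) \<le> 0.9 / \<phi> 1 * norm (\<phi> (real k))"
    by (auto simp: eventually_sequentially)
  \<comment> \<open>For \<open>\<epsilon> > 1\<close> the index \<open>m0\<close> is admissible, so
    the minimal \<open>n\<close> is at most \<open>m0\<close>.\<close>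
  obtain m0 where m0: "H \<phi> m0 \<le> 1 / \<phi> 1"
  proof -
    have "eventually (\<lambda>m. H \<phi> m < 1 / \<phi> 1) sequentially"
      using order_tendstoD(2)[OF H_tendsto_0, of "1 / \<phi> 1"] phi_1_pos by simp
    then show ?thesis
      using that by (auto simp: eventually_sequentially intro: less_imp_le)
  qed
  define K where "K = max 1 K0"
  define N0 where "N0 = phi_inv \<phi> (1 / eps \<phi> m0)"
  \<comment> \<open>\<open>X\<close> bounds \<open>\<epsilon>\<close> to the power \<open>N\<close>
    for all \<open>\<epsilon> > 9 / 10\<close>: for \<open>\<epsilon> > 1\<close> the base is below
    \<open>\<phi> 1 * H \<phi> 1\<close> and the exponent is at most \<open>N0\<close>; the maximum
    with 1 covers \<open>\<epsilon> \<le> 1\<close>.\<close>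
  define X where "X = exp (N0 * ln (max 1 (\<phi> 1 * H \<phi> 1)))"
  have N0: "1 \<le> N0"
    unfolding N0_def by (rule phi_inv_ge_1)
  have X: "1 \<le> X"
    using N0 by (simp add: X_def)
  define C' :: real where "C' = (0.9 ^ K / 2) / X"
  show "\<exists>C'>0. \<forall>(M :: 'a measure) (g :: nat \<Rightarrow> 'a \<Rightarrow> real) \<epsilon> n.
        prob_space M \<and>
        prob_space.indep_vars M (\<lambda>_. borel) g {1..} \<and>
        (\<forall>k\<ge>1. distributed M lborel (g k) std_normal_density) \<and>
        0 < \<epsilon> / \<phi> 1 \<and> \<epsilon> / \<phi> 1 < H \<phi> 1 \<and> H \<phi> n \<le> \<epsilon> / \<phi> 1 \<and>
        (\<epsilon> \<le> 1 \<or> (\<forall>m. H \<phi> m \<le> \<epsilon> / \<phi> 1 \<longrightarrow> n \<le> m)) \<longrightarrow>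
        measure M {\<omega> \<in> space M. (SUP k\<in>{1..}. ereal \<bar>g k \<omega> / \<phi> (real k)\<bar>) \<le> ereal (2 / \<phi> 1 * \<epsilon>)}
          \<ge> (if \<epsilon> \<le> 9 / 10 then 1 / 2 else C') * exp (- phi_inv \<phi> (1 / eps \<phi> n) * ln (1 / \<epsilon>))"
  proof (intro exI[of _ C'] conjI allI impI)
    show "0 < C'"
      using X by (simp add: C'_def)
  next
    fix M :: "'a measure" and g :: "nat \<Rightarrow> 'a \<Rightarrow> real" and \<epsilon> n
    assume asm: "prob_space M \<and>
        prob_space.indep_vars M (\<lambda>_. borel) g {1..} \<and>
        (\<forall>k\<ge>1. distributed M lborel (g k) std_normal_density) \<and>
        0 < \<epsilon> / \<phi> 1 \<and> \<epsilon> / \<phi> 1 < H \<phi> 1 \<and> H \<phi> n \<le> \<epsilon> / \<phi> 1 \<and>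
        (\<epsilon> \<le> 1 \<or> (\<forall>m. H \<phi> m \<le> \<epsilon> / \<phi> 1 \<longrightarrow> n \<le> m))"
    then interpret prob_space M by simp
    have indep: "indep_vars (\<lambda>_. borel) g {1..}"
      and g: "\<And>k. 1 \<le> k \<Longrightarrow> distributed M lborel (g k) std_normal_density"
      using asm by auto
    define N where "N = phi_inv \<phi> (1 / eps \<phi> n)"
    define c where "c k = 2 / \<phi> 1 * \<epsilon> * \<phi> (real k)" for k
    have \<epsilon>: "0 < \<epsilon>" "\<epsilon> < \<phi> 1 * H \<phi> 1"
      using asm phi_1_pos by (auto simp: field_simps zero_less_mult_iff)
    have N: "1 \<le> N"
      unfolding N_def by (rule phi_inv_ge_1)
    have c_ge: "2 * \<epsilon> \<le> c k" if "1 \<le> k" for k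
    proof -
      have "2 * \<epsilon> = 2 / \<phi> 1 * \<epsilon> * \<phi> 1" using phi_1_pos by simp
      also have "\<dots> \<le> c k"
        unfolding c_def using that \<epsilon> phi_1_pos phi_ge[of "real k"] by (intro mult_left_mono) auto
      finally show ?thesis .
    qed
    have "(if \<epsilon> \<le> 9 / 10 then 1 / 2 else C') * exp (- N * ln (1 / \<epsilon>))
        \<le> prob {\<omega> \<in> space M. \<forall>k\<ge>1. \<bar>g k \<omega>\<bar> \<le> c k}"
    proof (cases "\<epsilon> \<le> 9 / 10")
      case True
      \<comment> \<open>\<open>L\<close> counts the integers \<open>k \<ge> 1\<close> with
        \<open>k \<le> N\<close>. Rounding the exponent down only increases the power, since
        \<open>ln \<epsilon> < 0\<close>, and an integer above \<open>L\<close> lies strictly above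
        \<open>N\<close>.\<close>
      define L where "L = nat \<lfloor>N\<rfloor>"
      have L: "1 \<le> L" "real L \<le> N"
        using N by (auto simp: L_def le_nat_floor)
      have "exp (- N * ln (1 / \<epsilon>)) = exp (N * ln \<epsilon>)"
        using \<epsilon> by (simp add: ln_div)
      also have "\<dots> \<le> exp (real L * ln \<epsilon>)"
        using L \<epsilon> True by (simp add: mult_right_mono_neg)
      also have "\<dots> = \<epsilon> ^ L"
        using \<epsilon> by (simp add: exp_of_nat_mult)
      finally have "1 / 2 * exp (- N * ln (1 / \<epsilon>)) \<le> \<epsilon> ^ L / 2"
        by simp
      also have "\<dots> \<le> prob {\<omega> \<in> space M. \<forall>k\<ge>1. \<bar>g k \<omega>\<bar> \<le> c k}"
      proof (rule prob_indep_std_normal_bounded_ge[OF indep g])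
        fix k assume "L < k"
        then have k: "N < real k" "1 \<le> k"
          using L by (auto simp: L_def) linarith
        have "sqrt (ln (real k)) / \<phi> (real k) \<le> \<epsilon> / \<phi> 1"
          using sqrt_ln_div_phi_le_H[OF k(1)[unfolded N_def]] asm by linarith
        then have "sqrt (ln (real k)) \<le> \<epsilon> / \<phi> 1 * \<phi> (real k)"
          using phi_pos[OF k(2)] by (simp only: pos_divide_le_eq)
        then show "2 * sqrt (ln (real k)) \<le> c k"
          by (simp add: c_def)
      qed (use \<epsilon> True L c_ge in auto)
      finally show ?thesis using True by simp
    next
      case False
      have "C' * exp (- N * ln (1 / \<epsilon>)) \<le> C' * X"
      proof (rule mult_left_mono)
        show "exp (- N * ln (1 / \<epsilon>)) \<le> X"
        \<comment> \<open>Up to 1 the exponential is at most 1 for every \<open>n\<close>; beyond 1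
          minimality of \<open>n\<close> gives \<open>N \<le> N0\<close>.\<close>
        proof (cases "\<epsilon> \<le> 1")
          case True
          then have "N * ln \<epsilon> \<le> 0"
            using N \<epsilon> by (intro mult_nonneg_nonpos) auto
          then have "exp (- N * ln (1 / \<epsilon>)) \<le> 1"
            using \<epsilon> by (simp add: ln_div)
          then show ?thesis using X by linarith
        next
          case gt: False
          have "1 / \<phi> 1 \<le> \<epsilon> / \<phi> 1"
            using gt phi_1_pos by (simp add: divide_right_mono)
          then have "n \<le> m0"
            using asm m0 gt by auto
          then have "N \<le> N0"
            unfolding N_def N0_def using eps_antimono eps_pos
            by (intro phi_inv_mono divide_left_mono) auto
          then have "N * ln \<epsilon> \<le> N0 * ln (max 1 (\<phi> 1 * H \<phi> 1))"
            using gt \<epsilon> N by (intro mult_mono) auto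
          then show ?thesis
            using \<epsilon> by (simp add: X_def ln_div)
        qed
      qed (use X in \<open>simp add: C'_def\<close>)
      also have "\<dots> = 0.9 ^ K / 2"
        using X by (simp add: C'_def)
      also have "\<dots> \<le> prob {\<omega> \<in> space M. \<forall>k\<ge>1. \<bar>g k \<omega>\<bar> \<le> c k}"
      proof (rule prob_indep_std_normal_bounded_ge[OF indep g])
        fix k :: nat assume "1 \<le> k"
        with c_ge[of k] False show "2 * 0.9 \<le> c k" by simp
      next
        fix k assume k: "K < k"
        have "0 < \<phi> (real k)" "0 \<le> ln (real k)"
          using k phi_pos[of k] by (auto simp: K_def)
        then have "2 * sqrt (ln (real k)) \<le> 2 / \<phi> 1 * 0.9 * \<phi> (real k)"
          using K0[of k] k by (simp add: K_def)
        also have "\<dots> \<le> c k"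
          unfolding c_def using False phi_1_pos \<open>0 < \<phi> (real k)\<close>
          by (intro mult_right_mono mult_left_mono) auto
        finally show "2 * sqrt (ln (real k)) \<le> c k" .
      qed (auto simp: K_def)
      finally show ?thesis using False by simp
    qed
    also have "{\<omega> \<in> space M. \<forall>k\<ge>1. \<bar>g k \<omega>\<bar> \<le> c k}
        = {\<omega> \<in> space M. (SUP k\<in>{1..}. ereal \<bar>g k \<omega> / \<phi> (real k)\<bar>) \<le> ereal (2 / \<phi> 1 * \<epsilon>)}"
      using phi_pos by (subst ereal_SUP_abs_div_le_iff) (auto simp: c_def)
    finally show "measure M {\<omega> \<in> space M. (SUP k\<in>{1..}. ereal \<bar>g k \<omega> / \<phi> (real k)\<bar>) \<le> ereal (2 / \<phi> 1 * \<epsilon>)}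
          \<ge> (if \<epsilon> \<le> 9 / 10 then 1 / 2 else C') * exp (- phi_inv \<phi> (1 / eps \<phi> n) * ln (1 / \<epsilon>))"
      unfolding N_def .
  qed
qed

end
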